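(* Let $n\ge 3$ be an integer and let $v_1,\dots,v_{n-1}$ be real numbers with $0=v_1<v_2<\dots<v_{n-1}=1$ (so that, with $v_n=\infty$, the points $v_1,\dots,v_n$ are the vertices of an ideal hyperbolic polygon in the upper half plane). Then $$\mathop{\sum\sum}_{1\le j<i\le n-2}\mathcal{L}\bigl([v_i,v_{i+1},v_j,v_{j+1}]\bigr)+\sum_{i=1}^{n-2}\sum_{j=1}^{n-2}\sum_{k=1}^{\infty}\mathcal{L}\bigl([v_i,v_{i+1},k+v_j,k+v_{j+1}]\bigr)=\frac{(n-2)\pi^2}{3}.$$
   Context: The Rogers dilogarithm is the function on $[0,1]$ given by $\mathcal{L}(z)=\mathrm{Li}_2(z)+\frac12\log|z|\log(1-z)$, where $\mathrm{Li}_2(z)=\sum_{n\ge1}z^n/n^2$, with $\mathcal{L}(0)=0$ and $\mathcal{L}(1)=\pi^2/6$. The cross ratio of four points of $\hat{\mathbb{C}}$, at least three of which are distinct, is $$[z_1,z_2,z_3,z_4]=\frac{(z_1-z_2)(z_4-z_3)}{(z_1-z_3)(z_4-z_2)}.$$ *)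

theory Defs
  imports Complex_Main
begin

definition Li2 :: "real \<Rightarrow> real" where
  "Li2 z = (\<Sum>n. z ^ Suc n / (real (Suc n))\<^sup>2)"

text \<open>Only the values on the interval from 0 to 1 are meaningful.\<close>

definition rogers_dilog :: "real \<Rightarrow> real" where
  "rogers_dilog z =
     (if z = 0 then 0
      else if z = 1 then pi\<^sup>2 / 6
      else Li2 z + 1 / 2 * ln \<bar>z\<bar> * ln (1 - z))"

text \<open>
  The cross ratio of four finite points. Where \<open>z1 = z3\<close> or \<open>z4 = z2\<close> (the value on the
  Riemann sphere being infinity if three of the points are distinct), division by zero
  yields \<open>0\<close> instead.
\<close>

definition cross_ratio :: "'a::field \<Rightarrow> 'a \<Rightarrow> 'a \<Rightarrow> 'a \<Rightarrow> 'a" where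
  "cross_ratio z1 z2 z3 z4 = ((z1 - z2) * (z4 - z3)) / ((z1 - z3) * (z4 - z2))"

end

theory Submission
  imports Defs "HOL-Analysis.Analysis" "HOL-Real_Asymp.Real_Asymp"
begin

text \<open>
  Extend the points periodically by \<open>v (i + n - 2) = v i + 1\<close>: the statement sums \<open>\<L>\<close> of the
  cross ratio of two intervals over all pairs of distinct intervals modulo translation. For
  \<open>a < b \<le> c < d\<close>, the five-term relation with the fifth point at infinity reads
  \<open>\<L> [a, b, c, d] = (h c - h d) + (p a - p b)\<close>, where \<open>h t = \<L> ((b - a) / (t - a))\<close> depends only
  on the interval \<open>(a, b)\<close> and \<open>p s = \<L> ((c - s) / (d - s))\<close> only on \<open>(c, d)\<close>. Summed over all
  intervals to the right of \<open>(a, b)\<close>, the first bracket telescopes to \<open>\<L> 1 - \<L> 0 = \<pi>\<^sup>2 / 6\<close>; by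
  translation invariance the second is summed over all intervals to the left of \<open>(c, d)\<close> and
  telescopes to the same value.
\<close>

section \<open>The dilogarithm series on the unit interval\<close>

lemma summable_Li2:
  fixes z :: real
  assumes "\<bar>z\<bar> \<le> 1"
  shows "summable (\<lambda>n. z ^ Suc n / (real (Suc n))\<^sup>2)"
proof (rule summable_comparison_test')
  show "summable (\<lambda>n. 1 / (real (Suc n))\<^sup>2)"
    using inverse_squares_sums by (auto simp: sums_iff add_ac)
  show "norm (z ^ Suc n / (real (Suc n))\<^sup>2) \<le> 1 / (real (Suc n))\<^sup>2" for n
    using assms power_le_one[of "\<bar>z\<bar>" "Suc n"]
    by (auto simp: abs_mult power_abs divide_simps simp del: power_Suc)
qed

lemma Li2_0: "Li2 0 = 0"
  by (simp add: Li2_def)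

lemma Li2_1: "Li2 1 = pi\<^sup>2 / 6"
  using inverse_squares_sums by (auto simp: Li2_def sums_iff add_ac)

lemma continuous_on_Li2: "continuous_on {0..1} Li2"
proof -
  have "uniform_limit {0..1} (\<lambda>n z. \<Sum>i<n. z ^ Suc i / (real (Suc i))\<^sup>2)
          (\<lambda>z. \<Sum>n. z ^ Suc n / (real (Suc n))\<^sup>2) sequentially"
  proof (rule Weierstrass_m_test)
    show "summable (\<lambda>n. 1 / (real (Suc n))\<^sup>2)"
      using inverse_squares_sums by (auto simp: sums_iff add_ac)
    show "norm (z ^ Suc n / (real (Suc n))\<^sup>2) \<le> 1 / (real (Suc n))\<^sup>2"
      if "z \<in> {0..1}" for n and z :: real
      using that power_le_one[of z "Suc n"]
      by (auto simp: abs_mult power_abs divide_simps simp del: power_Suc)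
  qed
  then show ?thesis
    unfolding Li2_def [abs_def]
    by (rule uniform_limit_theorem[rotated]) (auto intro!: always_eventually continuous_intros)
qed

text \<open>Termwise differentiation leaves the series of \<open>z ^ n / (n + 1)\<close>, which is
  the Taylor series of \<open>- ln (1 - z)\<close> divided by \<open>z\<close>.\<close>

lemma DERIV_Li2:
  assumes "0 < z" "z < 1"
  shows "(Li2 has_real_derivative - ln (1 - z) / z) (at z)"
proof -
  \<comment> \<open>Division by zero gives \<open>c 0 = 0\<close>, so the series starting at
    exponent \<open>1\<close> becomes a full power series.\<close>
  define c where "c n = 1 / (real n)\<^sup>2" for n
  have Li2_eq: "Li2 x = (\<Sum>n. c n * x ^ n)" if "\<bar>x\<bar> < 1" for x
  proof -
    have "(\<lambda>n. c (Suc n) * x ^ Suc n) sums Li2 x"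
      using summable_sums[OF summable_Li2[of x]] that by (simp add: Li2_def c_def)
    then show ?thesis
      by (subst (asm) sums_Suc_iff) (simp add: c_def sums_iff)
  qed
  have summ: "summable (\<lambda>n. c n * x ^ n)" if "norm x < 1" for x
    using summable_Li2[of x] that
    by (subst summable_Suc_iff[symmetric]) (simp add: c_def)
  have deriv: "((\<lambda>x. \<Sum>n. c n * x ^ n) has_real_derivative (\<Sum>n. diffs c n * z ^ n)) (at z)"
    by (rule termdiffs_strong'[of 1]) (use summ assms in auto)
  have ev: "eventually (\<lambda>x. x \<in> {0<..<1}) (nhds z)"
    by (rule eventually_nhds_in_open) (use assms in auto)
  have "(Li2 has_real_derivative (\<Sum>n. diffs c n * z ^ n)) (at z)"
    using deriv by (subst DERIV_cong_ev[OF refl _ refl]) (use ev Li2_eq in \<open>auto elim!: eventually_mono\<close>)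
  moreover have "(\<lambda>n. diffs c n * z ^ n) sums (- ln (1 - z) / z)"
  proof -
    have "(\<lambda>n. - ((z) ^ n) / real n) sums ln (1 - z)"
      using ln_series'[of "- z"] assms by simp
    then have "(\<lambda>n. - (z ^ Suc n) / real (Suc n)) sums ln (1 - z)"
      by (subst sums_Suc_iff) simp
    then have "(\<lambda>n. (- 1 / z) * (- (z ^ Suc n) / real (Suc n))) sums ((- 1 / z) * ln (1 - z))"
      by (rule sums_mult)
    moreover have "(- 1 / z) * (- (z ^ Suc n) / real (Suc n)) = diffs c n * z ^ n" for n
      using assms by (simp add: diffs_def c_def power2_eq_square divide_simps)
    ultimately show ?thesis by simp
  qed
  ultimately show ?thesis by (simp add: sums_iff)
qed

lemma Li2_nonneg: "0 \<le> z \<Longrightarrow> z \<le> 1 \<Longrightarrow> 0 \<le> Li2 z"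
  unfolding Li2_def by (intro suminf_nonneg summable_Li2) auto

section \<open>The Rogers dilogarithm: sign, continuity, derivative\<close>

text \<open>At either endpoint one of the two factors is \<open>ln 1 = 0\<close>, so the product
  vanishes and the case distinction disappears.\<close>

lemma rogers_dilog_eq:
  assumes "0 \<le> z" "z \<le> 1"
  shows "rogers_dilog z = Li2 z + 1 / 2 * ln z * ln (1 - z)"
  using assms by (auto simp: rogers_dilog_def Li2_0 Li2_1)

lemma rogers_dilog_nonneg: "0 \<le> z \<Longrightarrow> z \<le> 1 \<Longrightarrow> 0 \<le> rogers_dilog z"
  by (cases "z = 0 \<or> z = 1")
    (auto simp: rogers_dilog_def Li2_nonneg intro!: add_nonneg_nonneg mult_nonpos_nonpos)

lemma rogers_dilog_0 [simp]: "rogers_dilog 0 = 0"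
  and rogers_dilog_1 [simp]: "rogers_dilog 1 = pi\<^sup>2 / 6"
  by (simp_all add: rogers_dilog_def)

text \<open>Only the endpoints need an argument: \<open>ln z * ln (1 - z)\<close> tends to
  \<open>0\<close> there because a simple zero outweighs a logarithmic pole.\<close>

lemma continuous_on_rogers_dilog: "continuous_on {0..1} rogers_dilog"
proof -
  have "continuous_on {0..1} (\<lambda>z::real. ln z * ln (1 - z))"
  proof (rule continuous_on_IccI)
    show "((\<lambda>z::real. ln z * ln (1 - z)) \<longlongrightarrow> ln 0 * ln (1 - 0)) (at_right 0)"
      by simp real_asymp
    show "((\<lambda>z::real. ln z * ln (1 - z)) \<longlongrightarrow> ln 1 * ln (1 - 1)) (at_left 1)"
      by simp real_asymp
  qed (auto intro!: tendsto_eq_intros)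
  then have "continuous_on {0..1} (\<lambda>z. Li2 z + 1 / 2 * (ln z * ln (1 - z)))"
    by (rule continuous_on_add[OF continuous_on_Li2 continuous_on_mult_left])
  then show ?thesis
    by (rule continuous_on_eq) (auto simp: rogers_dilog_eq)
qed

text \<open>
  Logarithmic form of the derivative: for curves with explicit \<open>ln (u s)\<close> and \<open>ln (1 - u s)\<close>,
  linear relations between these logarithms turn functional equations into ring identities.
\<close>

lemma DERIV_rogers_dilog_exp:
  fixes U W :: "real \<Rightarrow> real"
  assumes U: "(U has_real_derivative U') (at t)" and W: "(W has_real_derivative W') (at t)"
    and ev: "eventually (\<lambda>s. u s = exp (U s) \<and> 1 - u s = exp (W s)) (nhds t)"
  shows "((\<lambda>s. rogers_dilog (u s)) has_real_derivative - (W t * U' - U t * W') / 2) (at t)"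
proof -
  have ut: "u t = exp (U t)" "1 - u t = exp (W t)"
    using eventually_nhds_x_imp_x[OF ev] by auto
  have u01: "0 < u t" "u t < 1"
    using ut exp_gt_zero[of "U t"] exp_gt_zero[of "W t"] by linarith+
  have du: "(u has_real_derivative u t * U') (at t)"
  proof -
    have "((\<lambda>s. exp (U s)) has_real_derivative exp (U t) * U') (at t)"
      by (auto intro!: derivative_eq_intros U)
    then show ?thesis
      using ut(1)
      by (subst DERIV_cong_ev[OF refl _ refl]) (use ev in \<open>auto elim!: eventually_mono\<close>)
  qed
  have dw: "((\<lambda>s. 1 - u s) has_real_derivative (1 - u t) * W') (at t)"
  proof -
    have "((\<lambda>s. exp (W s)) has_real_derivative exp (W t) * W') (at t)"
      by (auto intro!: derivative_eq_intros W)
    then show ?thesis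
      using ut(2)
      by (subst DERIV_cong_ev[OF refl _ refl]) (use ev in \<open>auto elim!: eventually_mono\<close>)
  qed
  have rel: "(1 - u t) * W' = - (u t * U')"
    by (rule DERIV_unique[OF dw]) (auto intro!: derivative_eq_intros du)
  \<comment> \<open>\<open>Li2\<close> contributes \<open>- W t * U'\<close> and the product of
    logarithms \<open>(U' * W t + U t * W') / 2\<close>; together they are antisymmetric in
    \<open>U\<close> and \<open>W\<close>.\<close>
  have "((\<lambda>s. Li2 (u s) + 1 / 2 * U s * W s) has_real_derivative
      - (W t * U' - U t * W') / 2) (at t)"
  proof -
    have L: "((\<lambda>s. Li2 (u s)) has_real_derivative (- ln (1 - u t) / u t) * (u t * U')) (at t)"
      by (rule DERIV_chain2[OF DERIV_Li2 du]) (use u01 in auto)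
    have "(- ln (1 - u t) / u t) * (u t * U') = - W t * U'"
      using u01 ut by simp
    with L show ?thesis
      by (auto intro!: derivative_eq_intros U W simp: field_simps)
  qed
  moreover have "eventually (\<lambda>s. Li2 (u s) + 1 / 2 * U s * W s = rogers_dilog (u s)) (nhds t)"
    using ev
  proof eventually_elim
    case (elim s)
    then have "0 < u s" "u s < 1"
      using exp_gt_zero[of "U s"] exp_gt_zero[of "W s"] by linarith+
    then have "rogers_dilog (u s) = Li2 (u s) + 1 / 2 * ln (u s) * ln (1 - u s)"
      by (simp add: rogers_dilog_eq)
    moreover have "ln (u s) = U s" "ln (1 - u s) = W s"
      using elim by (metis ln_exp)+
    ultimately show ?case by (simp only:)
  qed
  ultimately show ?thesis
    by (simp add: DERIV_cong_ev[OF refl _ refl])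
qed

section \<open>Cross ratios and the five-term relation\<close>

lemma cross_ratio_commute: "cross_ratio z3 z4 z1 z2 = cross_ratio z1 z2 z3 z4"
proof -
  have "(z3 - z1) * (z2 - z4) = (z1 - z3) * (z4 - z2)" "(z3 - z4) * (z2 - z1) = (z1 - z2) * (z4 - z3)"
    by (simp_all add: algebra_simps)
  then show ?thesis by (simp add: cross_ratio_def)
qed

lemma cross_ratio_ordered:
  "cross_ratio a b c d = (b - a) * (d - c) / ((c - a) * (d - b))"
proof -
  have "(a - b) * (d - c) = - ((b - a) * (d - c))" "(a - c) * (d - b) = - ((c - a) * (d - b))"
    by (simp_all add: algebra_simps)
  then show ?thesis by (simp add: cross_ratio_def)
qed

text \<open>By a Ptolemy identity the denominator exceeds the numerator by
  \<open>(c - b) * (d - a)\<close>. The case \<open>c = d\<close> is included because the five-term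
  relation is anchored at that degenerate position.\<close>

lemma cross_ratio_Icc:
  fixes a b c d :: real
  assumes "a < b" "b \<le> c" "c \<le> d"
  shows "cross_ratio a b c d \<in> {0..1}"
proof -
  have "(c - a) * (d - b) - (b - a) * (d - c) = (c - b) * (d - a)"
    by (simp add: algebra_simps)
  then have "(b - a) * (d - c) \<le> (c - a) * (d - b)"
    using assms mult_nonneg_nonneg[of "c - b" "d - a"] by linarith
  moreover have "0 \<le> (b - a) * (d - c)" "0 \<le> (c - a) * (d - b)"
    using assms by simp_all
  \<comment> \<open>\<open>y = 0\<close> occurs when \<open>b = c = d\<close>; the quotient is then
    \<open>0\<close>.\<close>
  moreover have "x / y \<in> {0..1}" if "x \<le> y" "0 \<le> x" "0 \<le> y" for x y :: real
    using that by (auto simp: divide_le_eq_1)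
  ultimately show ?thesis
    unfolding cross_ratio_ordered by blast
qed

text \<open>The last point is moved from \<open>d\<close> down to \<open>c\<close>: the combination
  \<open>D\<close> of the terms that depend on it has derivative zero, and its value at
  \<open>c\<close> is explicit.\<close>

lemma rogers_dilog_five_term:
  fixes a b c d :: real
  assumes "a < b" "b \<le> c" "c < d"
  shows "rogers_dilog (cross_ratio a b c d) =
      rogers_dilog ((b - a) / (c - a)) - rogers_dilog ((b - a) / (d - a))
      + rogers_dilog ((c - a) / (d - a)) - rogers_dilog ((c - b) / (d - b))"
proof (cases "b = c")
  \<comment> \<open>The cross ratio is \<open>1\<close>, the two middle terms on the right cancel,
    and \<open>rogers_dilog 1\<close> remains. For \<open>b < c\<close> the denominators
    \<open>t - a\<close> and \<open>t - b\<close> stay positive on \<open>{c..d}\<close>.\<close>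
  case True
  then show ?thesis using assms by (simp add: cross_ratio_ordered)
next
  case False
  with assms have ord: "a < b" "b < c" "c < d" by auto
  define D where "D t = rogers_dilog (cross_ratio a b c t)
      + rogers_dilog ((b - a) / (t - a)) - rogers_dilog ((c - a) / (t - a))
      + rogers_dilog ((c - b) / (t - b))" for t
  have "(D has_real_derivative 0) (at t)" if "c < t" for t
  proof -
    have ev: "eventually (\<lambda>s. s > c) (nhds t)"
      using eventually_nhds_in_open[of "{c<..}" t] that by simp
    have 1: "((\<lambda>s. rogers_dilog (cross_ratio a b c s)) has_real_derivative
        - ((ln (c - b) + ln (t - a) - ln (c - a) - ln (t - b)) * (1 / (t - c) - 1 / (t - b))
           - (ln (b - a) + ln (t - c) - ln (c - a) - ln (t - b)) * (1 / (t - a) - 1 / (t - b))) / 2) (at t)"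
      apply (rule DERIV_rogers_dilog_exp[where
          U = "\<lambda>s. ln (b - a) + ln (s - c) - ln (c - a) - ln (s - b)" and
          W = "\<lambda>s. ln (c - b) + ln (s - a) - ln (c - a) - ln (s - b)"])
      subgoal using that ord by (auto intro!: derivative_eq_intros)
      subgoal using that ord by (auto intro!: derivative_eq_intros)
      subgoal using ev
      proof eventually_elim
        case (elim s)
        \<comment> \<open>The complement also factors into differences of the points, so its
          logarithm is again a signed sum of logarithms of differences.\<close>
        have "1 - cross_ratio a b c s = (c - b) * (s - a) / ((c - a) * (s - b))"
          using elim ord by (simp add: cross_ratio_ordered divide_simps) (simp add: algebra_simps)
        then show ?case
          using elim ord by (simp add: cross_ratio_ordered exp_add exp_diff)
      qed
      done
    have 2: "((\<lambda>s. rogers_dilog ((q - p) / (s - p))) has_real_derivative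
        - ((ln (t - q) - ln (t - p)) * (- (1 / (t - p)))
           - (ln (q - p) - ln (t - p)) * (1 / (t - q) - 1 / (t - p))) / 2) (at t)"
      if pq: "p < q" "q \<le> c" for p q
      apply (rule DERIV_rogers_dilog_exp[where
          U = "\<lambda>s. ln (q - p) - ln (s - p)" and W = "\<lambda>s. ln (s - q) - ln (s - p)"])
      subgoal using \<open>c < t\<close> pq by (auto intro!: derivative_eq_intros)
      subgoal using \<open>c < t\<close> pq by (auto intro!: derivative_eq_intros)
      subgoal using ev by eventually_elim (use pq in \<open>simp add: exp_diff field_simps\<close>)
      done
    note DERIV_add[OF DERIV_diff[OF DERIV_add[OF 1 2[of a b]] 2[of a c]] 2[of b c]]
    then have "(D has_real_derivative
        - ((ln (c - b) + ln (t - a) - ln (c - a) - ln (t - b)) * (1 / (t - c) - 1 / (t - b))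
           - (ln (b - a) + ln (t - c) - ln (c - a) - ln (t - b)) * (1 / (t - a) - 1 / (t - b))) / 2
        + - ((ln (t - b) - ln (t - a)) * (- (1 / (t - a)))
           - (ln (b - a) - ln (t - a)) * (1 / (t - b) - 1 / (t - a))) / 2
        - - ((ln (t - c) - ln (t - a)) * (- (1 / (t - a)))
           - (ln (c - a) - ln (t - a)) * (1 / (t - c) - 1 / (t - a))) / 2
        + - ((ln (t - c) - ln (t - b)) * (- (1 / (t - b)))
           - (ln (c - b) - ln (t - b)) * (1 / (t - c) - 1 / (t - b))) / 2) (at t)"
      (is "(D has_real_derivative ?D') (at t)")
      unfolding D_def [abs_def] using ord by auto
    moreover have "?D' = 0"
    proof -
      \<comment> \<open>With all logarithms and reciprocals replaced by free variables, the
        vanishing is a polynomial identity.\<close>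
      have "- ((lcb + la - lca - lb) * (C - B) - (lba + lc - lca - lb) * (A - B)) / 2
          + - ((lb - la) * - A - (lba - la) * (B - A)) / 2
          - - ((lc - la) * - A - (lca - la) * (C - A)) / 2
          + - ((lc - lb) * - B - (lcb - lb) * (C - B)) / 2 = 0" for A B C la lb lc lba lca lcb :: real
        by (simp add: field_simps)
      then show ?thesis .
    qed
    ultimately show ?thesis by (simp only:)
  qed
  moreover have "continuous_on {c..d} D"
  proof -
    have "continuous_on {c..d} (\<lambda>t. rogers_dilog (cross_ratio a b c t))"
    proof (rule continuous_on_compose2[OF continuous_on_rogers_dilog])
      show "continuous_on {c..d} (cross_ratio a b c)"
        unfolding cross_ratio_ordered using ord by (auto intro!: continuous_intros)
      show "cross_ratio a b c ` {c..d} \<subseteq> {0..1}"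
        using ord cross_ratio_Icc[of a b c] by fastforce
    qed
    moreover have "continuous_on {c..d} (\<lambda>t. rogers_dilog ((q - p) / (t - p)))"
      if "p < q" "q \<le> c" for p q
      by (rule continuous_on_compose2[OF continuous_on_rogers_dilog])
        (use that in \<open>auto intro!: continuous_intros\<close>)
    ultimately show ?thesis
      unfolding D_def using ord by (intro continuous_intros) auto
  qed
  \<comment> \<open>At \<open>t = c\<close> the cross ratio is \<open>0\<close> and the last two
    terms of \<open>D\<close> are both \<open>rogers_dilog 1\<close> with opposite signs.\<close>
  ultimately have "D d = D c"
    using ord by (intro DERIV_isconst2[of c d]) auto
  then show ?thesis
    using ord by (simp add: D_def cross_ratio_ordered)
qed

section \<open>Telescoping over the translated intervals\<close>

lemma sum_telescope_atLeastAtMost: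
  fixes f :: "nat \<Rightarrow> 'a::ab_group_add"
  assumes "m \<le> Suc n"
  shows "(\<Sum>i = m..n. f i - f (i + 1)) = f m - f (n + 1)"
  using sum_Suc_diff[OF assms, of "\<lambda>i. - f i"] by (simp add: algebra_simps)

theorem theorem1p2:
  fixes n :: nat and v :: "nat \<Rightarrow> real"
  assumes "n \<ge> 3"
    and "v 1 = 0" and "v (n - 1) = 1"
    and "strict_mono_on {1..n - 1} v"
  shows "(\<forall>i\<in>{1..n - 2}. \<forall>j\<in>{1..n - 2}. summable (\<lambda>k.
            rogers_dilog (cross_ratio (v i) (v (i + 1))
              (real (Suc k) + v j) (real (Suc k) + v (j + 1)))))
       \<and> (\<Sum>i = 1..n - 2. \<Sum>j = 1..<i.
            rogers_dilog (cross_ratio (v i) (v (i + 1)) (v j) (v (j + 1))))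
         + (\<Sum>i = 1..n - 2. \<Sum>j = 1..n - 2. \<Sum>k.
              rogers_dilog (cross_ratio (v i) (v (i + 1))
                (real (Suc k) + v j) (real (Suc k) + v (j + 1))))
         = real (n - 2) * pi\<^sup>2 / 3"
proof -
  define N where "N = n - 2"
  have N: "n - 1 = N + 1" "n - 2 = N" using assms(1) by (simp_all add: N_def)
  have v1: "v 1 = 0" and vN: "v (N + 1) = 1" using assms N by simp_all
  have less: "v i < v j" if "1 \<le> i" "i < j" "j \<le> N + 1" for i j
    using strict_mono_onD[OF assms(4), of i j] that N by auto
  have le: "v i \<le> v j" if "1 \<le> i" "i \<le> j" "j \<le> N + 1" for i j
    using less[of i j] that by (cases "i = j") auto
  have range: "0 \<le> v i" "v i \<le> 1" if "1 \<le> i" "i \<le> N + 1" for i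
    using le[of 1 i] le[of i "N + 1"] that v1 vN by auto

  define h where "h i t = rogers_dilog ((v (i + 1) - v i) / (t - v i))" for i t
  define p where "p s j = rogers_dilog ((v j - s) / (v (j + 1) - s))" for s j
  define F where "F i j k = rogers_dilog (cross_ratio (v i) (v (i + 1))
      (real (Suc k) + v j) (real (Suc k) + v (j + 1)))" for i j k
  define G where "G i j = rogers_dilog (cross_ratio (v i) (v (i + 1)) (v j) (v (j + 1)))" for i j

  \<comment> \<open>In the second bracket the shift by \<open>Suc k\<close> is transferred from
    interval \<open>j\<close> to interval \<open>i\<close>, so that \<open>p\<close> always refers
    to the unshifted interval \<open>j\<close>.\<close>
  have F_eq: "F i j k = (h i (real (Suc k) + v j) - h i (real (Suc k) + v (j + 1)))
      + (p (v i - real (Suc k)) j - p (v (i + 1) - real (Suc k)) j)"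
    if "i \<in> {1..N}" "j \<in> {1..N}" for i j k
  proof -
    have "v (i + 1) \<le> real (Suc k) + v j"
      using range(2)[of "i + 1"] range(1)[of j] that by auto
    then have "F i j k = rogers_dilog ((v (i + 1) - v i) / (real (Suc k) + v j - v i))
        - rogers_dilog ((v (i + 1) - v i) / (real (Suc k) + v (j + 1) - v i))
        + rogers_dilog ((real (Suc k) + v j - v i) / (real (Suc k) + v (j + 1) - v i))
        - rogers_dilog ((real (Suc k) + v j - v (i + 1)) / (real (Suc k) + v (j + 1) - v (i + 1)))"
      unfolding F_def
      using less[of i "i + 1"] less[of j "j + 1"] that by (intro rogers_dilog_five_term) auto
    then show ?thesis by (simp add: h_def p_def algebra_simps)
  qed
  have F_nonneg: "0 \<le> F i j k" if "i \<in> {1..N}" "j \<in> {1..N}" for i j k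
  proof -
    have "v (i + 1) \<le> real (Suc k) + v j"
      using range(2)[of "i + 1"] range(1)[of j] that by auto
    then show ?thesis
      using cross_ratio_Icc[of "v i" "v (i + 1)" "real (Suc k) + v j" "real (Suc k) + v (j + 1)"]
        less[of i "i + 1"] less[of j "j + 1"] that
      unfolding F_def by (intro rogers_dilog_nonneg) auto
  qed
  have G_eq: "G i j = (h j (v i) - h j (v (i + 1))) + (p (v j) i - p (v (j + 1)) i)"
    if "i \<in> {1..N}" "j \<in> {1..<i}" for i j
  proof -
    have "G i j = rogers_dilog (cross_ratio (v j) (v (j + 1)) (v i) (v (i + 1)))"
      unfolding G_def by (subst cross_ratio_commute) simp
    also have "\<dots> = (h j (v i) - h j (v (i + 1))) + (p (v j) i - p (v (j + 1)) i)"
      using less[of i "i + 1"] less[of j "j + 1"] le[of "j + 1" i] that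
      by (subst rogers_dilog_five_term) (auto simp: h_def p_def)
    finally show ?thesis .
  qed

  \<comment> \<open>The \<open>h\<close> part runs over \<open>i > j\<close> and starts at
    \<open>v (j + 1)\<close>, where \<open>h\<close> is \<open>rogers_dilog 1\<close>. The
    \<open>p\<close> part runs over \<open>j < i\<close> and ends at \<open>v i\<close>, where
    \<open>p\<close> is \<open>rogers_dilog 0\<close>.\<close>
  have G_sum: "(\<Sum>i = 1..N. \<Sum>j = 1..<i. G i j)
      = real N * (pi\<^sup>2 / 6) - (\<Sum>i = 1..N. h i 1) + (\<Sum>j = 1..N. p 0 j)"
  proof -
    have "(\<Sum>i = 1..N. \<Sum>j = 1..<i. h j (v i) - h j (v (i + 1)))
        = (\<Sum>i\<in>{1..N}. \<Sum>j | j \<in> {1..N} \<and> j < i. h j (v i) - h j (v (i + 1)))"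
      by (intro sum.cong) auto
    also have "\<dots> = (\<Sum>j\<in>{1..N}. \<Sum>i | i \<in> {1..N} \<and> j < i. h j (v i) - h j (v (i + 1)))"
      by (rule sum.swap_restrict) auto
    also have "\<dots> = (\<Sum>j = 1..N. \<Sum>i = j + 1..N. h j (v i) - h j (v (i + 1)))"
      by (intro sum.cong) auto
    also have "\<dots> = (\<Sum>j = 1..N. pi\<^sup>2 / 6 - h j 1)"
    proof (rule sum.cong)
      fix j assume j: "j \<in> {1..N}"
      then have "h j (v (j + 1)) = pi\<^sup>2 / 6"
        using less[of j "j + 1"] by (simp add: h_def)
      then show "(\<Sum>i = j + 1..N. h j (v i) - h j (v (i + 1))) = pi\<^sup>2 / 6 - h j 1"
        using sum_telescope_atLeastAtMost[of "j + 1" N "\<lambda>i. h j (v i)"] j vN by simp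
    qed simp
    finally have *: "(\<Sum>i = 1..N. \<Sum>j = 1..<i. h j (v i) - h j (v (i + 1)))
        = real N * (pi\<^sup>2 / 6) - (\<Sum>i = 1..N. h i 1)"
      by (simp add: sum_subtractf)
    have "(\<Sum>j = 1..<i. p (v j) i - p (v (j + 1)) i) = p 0 i" if "i \<in> {1..N}" for i
    proof -
      have "{1..<i} = {1..i - 1}" using that by auto
      then show ?thesis
        using sum_telescope_atLeastAtMost[of 1 "i - 1" "\<lambda>j. p (v j) i"] that v1
        by (simp add: p_def)
    qed
    then have "(\<Sum>i = 1..N. \<Sum>j = 1..<i. p (v j) i - p (v (j + 1)) i) = (\<Sum>i = 1..N. p 0 i)"
      by (intro sum.cong) auto
    moreover have "(\<Sum>i = 1..N. \<Sum>j = 1..<i. G i j)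
        = (\<Sum>i = 1..N. \<Sum>j = 1..<i. h j (v i) - h j (v (i + 1)))
        + (\<Sum>i = 1..N. \<Sum>j = 1..<i. p (v j) i - p (v (j + 1)) i)"
      unfolding sum.distrib[symmetric] by (intro sum.cong G_eq) auto
    ultimately show ?thesis
      using * by simp
  qed

  \<comment> \<open>As \<open>v\<close> runs from \<open>0\<close> to \<open>1\<close>, one period
    telescopes to a unit step: \<open>h\<close> in the sum over \<open>j\<close>, and
    \<open>p\<close>, after swapping, in the sum over \<open>i\<close>. Induction on
    \<open>K\<close> joins these steps.\<close>
  have F_sum: "(\<Sum>i = 1..N. \<Sum>j = 1..N. \<Sum>k<K. F i j k)
      = (\<Sum>i = 1..N. h i 1 - h i (real (Suc K))) + (\<Sum>j = 1..N. p (- real K) j - p 0 j)" for K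
  proof (induction K)
    case (Suc K)
    have "(\<Sum>i = 1..N. \<Sum>j = 1..N. F i j K)
        = (\<Sum>i = 1..N. \<Sum>j = 1..N. h i (real (Suc K) + v j) - h i (real (Suc K) + v (j + 1)))
        + (\<Sum>i = 1..N. \<Sum>j = 1..N. p (v i - real (Suc K)) j - p (v (i + 1) - real (Suc K)) j)"
      unfolding sum.distrib[symmetric] by (intro sum.cong F_eq) auto
    also have "(\<Sum>i = 1..N. \<Sum>j = 1..N. p (v i - real (Suc K)) j - p (v (i + 1) - real (Suc K)) j)
        = (\<Sum>j = 1..N. \<Sum>i = 1..N. p (v i - real (Suc K)) j - p (v (i + 1) - real (Suc K)) j)"
      by (rule sum.swap)
    also have "\<dots> = (\<Sum>j = 1..N. p (- real (Suc K)) j - p (- real K) j)"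
      using sum_telescope_atLeastAtMost[of 1 N "\<lambda>i. p (v i - real (Suc K)) j" for j] v1 vN
      by simp
    also have "(\<Sum>i = 1..N. \<Sum>j = 1..N. h i (real (Suc K) + v j) - h i (real (Suc K) + v (j + 1)))
        = (\<Sum>i = 1..N. h i (real (Suc K)) - h i (real (Suc (Suc K))))"
      using sum_telescope_atLeastAtMost[of 1 N "\<lambda>j. h i (real (Suc K) + v j)" for i] v1 vN
      by (simp add: add_ac)
    finally show ?case
      using Suc.IH by (simp add: sum.distrib sum_subtractf)
  qed simp

  have h_lim: "(\<lambda>K. h i (real (Suc K))) \<longlonglongrightarrow> 0" if "i \<in> {1..N}" for i
  proof -
    have "(\<lambda>K. (v (i + 1) - v i) / (real (Suc K) - v i)) \<longlonglongrightarrow> 0"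
      by real_asymp
    moreover have "(v (i + 1) - v i) / (real (Suc K) - v i) \<in> {0..1}" for K
      using less[of i "i + 1"] range(2)[of "i + 1"] that by (auto simp: divide_le_eq_1)
    ultimately show ?thesis
      using continuous_on_tendsto_compose[OF continuous_on_rogers_dilog, where l = 0]
      unfolding h_def by fastforce
  qed
  have p_lim: "(\<lambda>K. p (- real K) j) \<longlonglongrightarrow> pi\<^sup>2 / 6" if "j \<in> {1..N}" for j
  proof -
    have "(\<lambda>K. (v j - (- real K)) / (v (j + 1) - (- real K))) \<longlonglongrightarrow> 1"
      by real_asymp
    moreover have "(v j - (- real K)) / (v (j + 1) - (- real K)) \<in> {0..1}" for K
      using less[of j "j + 1"] range(1)[of j] that by (auto simp: divide_le_eq_1)
    ultimately show ?thesis
      using continuous_on_tendsto_compose[OF continuous_on_rogers_dilog, where l = 1]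
      unfolding p_def by fastforce
  qed
  have F_lim: "(\<lambda>K. \<Sum>i = 1..N. \<Sum>j = 1..N. \<Sum>k<K. F i j k)
      \<longlonglongrightarrow> (\<Sum>i = 1..N. h i 1 - 0) + (\<Sum>j = 1..N. pi\<^sup>2 / 6 - p 0 j)"
    unfolding F_sum by (intro tendsto_intros h_lim p_lim)

  \<comment> \<open>Only the total over all \<open>i\<close> and \<open>j\<close> telescopes. Since
    the terms are nonnegative, its bounded partial sums dominate those of each single
    series.\<close>
  have summ: "summable (F i j)" if ij: "i \<in> {1..N}" "j \<in> {1..N}" for i j
  proof -
    obtain B where B: "\<And>K. norm (\<Sum>i = 1..N. \<Sum>j = 1..N. \<Sum>k<K. F i j k) \<le> B"
      using convergent_imp_Bseq[OF convergentI[OF F_lim]] by (auto simp: Bseq_def)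
    show ?thesis
    proof (rule summableI_nonneg_bounded)
      fix K
      have "(\<Sum>k<K. F i j k) \<le> (\<Sum>j = 1..N. \<Sum>k<K. F i j k)"
        using ij by (intro member_le_sum) (auto intro!: sum_nonneg F_nonneg)
      also have "\<dots> \<le> (\<Sum>i = 1..N. \<Sum>j = 1..N. \<Sum>k<K. F i j k)"
        using ij by (intro member_le_sum[where f = "\<lambda>i. \<Sum>j = 1..N. \<Sum>k<K. F i j k"])
          (auto intro!: sum_nonneg F_nonneg)
      also have "\<dots> \<le> B" using B[of K] by (simp add: abs_le_iff)
      finally show "(\<Sum>k<K. F i j k) \<le> B" .
    qed (use F_nonneg ij in auto)
  qed
  have "(\<lambda>K. \<Sum>i = 1..N. \<Sum>j = 1..N. \<Sum>k<K. F i j k)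
      \<longlonglongrightarrow> (\<Sum>i = 1..N. \<Sum>j = 1..N. \<Sum>k. F i j k)"
    by (intro tendsto_sum summable_LIMSEQ summ)
  \<comment> \<open>The sums of \<open>h i 1\<close> and \<open>p 0 j\<close> cancel against those
    in \<open>G_sum\<close>; each side leaves \<open>N\<close> copies of
    \<open>pi\<^sup>2 / 6\<close>.\<close>
  from LIMSEQ_unique[OF this F_lim]
  have "(\<Sum>i = 1..N. \<Sum>j = 1..<i. G i j) + (\<Sum>i = 1..N. \<Sum>j = 1..N. \<Sum>k. F i j k)
      = real N * pi\<^sup>2 / 3"
    unfolding G_sum by (simp add: sum_subtractf)
  then show ?thesis
    using summ unfolding N F_def G_def by blast
qed

end
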